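(* Let $A,B$ be positive definite $n\times n$ complex matrices and $N\in\mathbb{N}$. Let $\beta_j(\nu)=2^{-j}k_j(2\nu)$ and $\gamma_j(\nu)=2^{1-j}k_j(2-2\nu)$. If $0\leq \nu\leq\frac{1}{2}$, then $$A\nabla_{\nu}B+\sum_{j=1}^{N}s_j(2\nu)\left(A\#_{1-\beta_j(\nu)}B+A\#_{1-2^{-j}-\beta_j(\nu)}B-2\,A\#_{1-2^{-j-1}-\beta_j(\nu)}B\right)\leq A\#_{\nu}B+2(1-\nu)\left(A\nabla B-A\#B\right).$$ On the other hand, if $\frac{1}{2}\leq \nu\leq 1$, then $$A\nabla_{\nu}B+\sum_{j=1}^{N}s_j(2-2\nu)\left(A\#_{\gamma_j(\nu)}B+A\#_{\gamma_j(\nu)+2^{1-j}}B-2\,A\#_{\gamma_j(\nu)+2^{-j}}B\right)\leq A\#_{\nu}B+2\nu\left(A\nabla B-A\#B\right).$$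
   Context: $[x]$ denotes the greatest integer $\le x$. For $\nu\in[0,1]$ and $j\geq 1$ put $k_j(\nu)=[2^{j-1}\nu]$, $r_j(\nu)=[2^{j}\nu]$ and $s_j(\nu)=(-1)^{r_j(\nu)}2^{j-1}\nu+(-1)^{r_j(\nu)+1}\left[\frac{r_j(\nu)+1}{2}\right]$. For positive definite matrices $A,B$ and $t\in\mathbb{R}$, $A\nabla_{t}B=(1-t)A+tB$ and $A\#_tB=A^{1/2}\left(A^{-1/2}BA^{-1/2}\right)^{t}A^{1/2}$; $A\nabla B=A\nabla_{1/2}B$ and $A\#B=A\#_{1/2}B$. For Hermitian matrices, $X\le Y$ means that $Y-X$ is positive semidefinite.
   Formalization: In the second inequality the exponents are halved: γ_j(ν)=2^{-j}k_j(2-2ν), with weights γ_j, γ_j+2^{-j}, γ_j+2^{-j-1}; as printed it fails for A=I, B=16I, ν=3/4, N=1 (16.75 > 14.75). *)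

theory Defs
  imports "HOL-Analysis.Analysis"
begin

text \<open>The index \<open>j\<close> is at least \<open>1\<close> throughout, so the subtraction \<open>j - 1\<close> never truncates.\<close>

definition k_idx :: "nat \<Rightarrow> real \<Rightarrow> int" where
  "k_idx j \<nu> = \<lfloor>2 ^ (j - 1) * \<nu>\<rfloor>"

definition r_idx :: "nat \<Rightarrow> real \<Rightarrow> int" where
  "r_idx j \<nu> = \<lfloor>2 ^ j * \<nu>\<rfloor>"

definition s_coef :: "nat \<Rightarrow> real \<Rightarrow> real" where
  "s_coef j \<nu> =
     (- 1) powi r_idx j \<nu> * 2 ^ (j - 1) * \<nu>
     + (- 1) powi (r_idx j \<nu> + 1) * of_int \<lfloor>(of_int (r_idx j \<nu>) + 1) / 2 :: real\<rfloor>"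

definition beta_exp :: "nat \<Rightarrow> real \<Rightarrow> real" where
  "beta_exp j \<nu> = 2 powi (- int j) * of_int (k_idx j (2 * \<nu>))"

text \<open>
  Correction of the printed formula. The source has \<open>\<gamma>\<^sub>j(\<nu>) = 2\<^sup>1\<^sup>-\<^sup>j k\<^sub>j(2 - 2\<nu>)\<close> together with the
  weights \<open>\<gamma>\<^sub>j\<close>, \<open>\<gamma>\<^sub>j + 2\<^sup>1\<^sup>-\<^sup>j\<close>, \<open>\<gamma>\<^sub>j + 2\<^sup>-\<^sup>j\<close>. With these the inequality for \<open>\<nu> \<ge> 1/2\<close> is false: for
  \<open>A = I\<close>, \<open>B = 16 I\<close>, \<open>\<nu> = 3/4\<close>, \<open>N = 1\<close> the left-hand side is \<open>16.75 I\<close> and the right-hand side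
  \<open>14.75 I\<close>. All these weights are twice too large. Halving them gives precisely the image of the
  case \<open>\<nu> \<le> 1/2\<close> under exchanging \<open>A\<close> with \<open>B\<close> and \<open>\<nu>\<close> with \<open>1 - \<nu>\<close>, since
  \<open>A #\<^sub>t B = B #\<^sub>1\<^sub>-\<^sub>t A\<close>: \<open>\<gamma>\<^sub>j(\<nu>) = \<beta>\<^sub>j(1 - \<nu>)\<close>, with weights \<open>\<gamma>\<^sub>j\<close>, \<open>\<gamma>\<^sub>j + 2\<^sup>-\<^sup>j\<close>, \<open>\<gamma>\<^sub>j + 2\<^sup>-\<^sup>j\<^sup>-\<^sup>1\<close>.
\<close>
definition gamma_exp :: "nat \<Rightarrow> real \<Rightarrow> real" where
  "gamma_exp j \<nu> = 2 powi (- int j) * of_int (k_idx j (2 - 2 * \<nu>))"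

definition adj :: "complex^'n^'n \<Rightarrow> complex^'n^'n" where
  "adj A = (\<chi> i j. cnj (A $ j $ i))"

definition hermitian :: "complex^'n^'n \<Rightarrow> bool" where
  "hermitian A \<longleftrightarrow> adj A = A"

definition unitary :: "complex^'n^'n \<Rightarrow> bool" where
  "unitary U \<longleftrightarrow> adj U ** U = mat 1 \<and> U ** adj U = mat 1"

definition quad_form :: "complex^'n^'n \<Rightarrow> complex^'n \<Rightarrow> complex" where
  "quad_form A x = (\<Sum>i\<in>UNIV. cnj (x $ i) * (A *v x) $ i)"

text \<open>The quadratic form of a Hermitian matrix is real-valued, so \<open>Re\<close> loses nothing below.\<close>

definition pos_semidef :: "complex^'n^'n \<Rightarrow> bool" where
  "pos_semidef A \<longleftrightarrow> hermitian A \<and> (\<forall>x. 0 \<le> Re (quad_form A x))"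

definition pos_def :: "complex^'n^'n \<Rightarrow> bool" where
  "pos_def A \<longleftrightarrow> hermitian A \<and> (\<forall>x. x \<noteq> 0 \<longrightarrow> 0 < Re (quad_form A x))"

definition loewner_le :: "complex^'n^'n \<Rightarrow> complex^'n^'n \<Rightarrow> bool" (infix \<open>\<le>\<^sub>L\<close> 50) where
  "X \<le>\<^sub>L Y \<longleftrightarrow> pos_semidef (Y - X)"

definition real_diag :: "('n \<Rightarrow> real) \<Rightarrow> complex^'n^'n" where
  "real_diag d = (\<chi> i j. if i = j then complex_of_real (d i) else 0)"

text \<open>
  Real powers of a positive definite matrix by functional calculus: \<open>A\<^sup>t = U diag(d\<^sub>i\<^sup>t) U\<^sup>*\<close> for any
  unitary diagonalization \<open>A = U diag(d\<^sub>i) U\<^sup>*\<close>. A diagonalization exists by the spectral theorem;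
  \<open>mat_powr_diagonalization\<close> below shows that the result does not depend on the choice.
\<close>
definition mat_powr :: "complex^'n^'n \<Rightarrow> real \<Rightarrow> complex^'n^'n" (infixr \<open>mpowr\<close> 80) where
  "A mpowr t = (THE X. \<exists>U d. unitary U \<and> (\<forall>i. 0 < d i) \<and>
      A = U ** real_diag d ** adj U \<and> X = U ** real_diag (\<lambda>i. d i powr t) ** adj U)"

definition amean :: "real \<Rightarrow> complex^'n^'n \<Rightarrow> complex^'n^'n \<Rightarrow> complex^'n^'n" where
  "amean t A B = (1 - t) *\<^sub>R A + t *\<^sub>R B"

definition gmean :: "real \<Rightarrow> complex^'n^'n \<Rightarrow> complex^'n^'n \<Rightarrow> complex^'n^'n" where
  "gmean t A B = (A mpowr (1/2)) **
     (((A mpowr (- 1/2)) ** B ** (A mpowr (- 1/2))) mpowr t) ** (A mpowr (1/2))"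

lemma real_diag_mult_left: "(real_diag d ** M) $ i $ j = complex_of_real (d i) * M $ i $ j"
  by (simp add: real_diag_def matrix_matrix_mult_def if_distrib if_distribR sum.If_cases cong: if_cong)

lemma real_diag_mult_right: "(M ** real_diag d) $ i $ j = M $ i $ j * complex_of_real (d j)"
  by (simp add: real_diag_def matrix_matrix_mult_def if_distrib if_distribR sum.If_cases cong: if_cong)

lemma unitary_diag_function_unique:
  fixes U V :: "complex^'n^'n"
  assumes U: "unitary U" and V: "unitary V"
    and eq: "U ** real_diag d ** adj U = V ** real_diag e ** adj V"
  shows "U ** real_diag (\<lambda>i. f (d i)) ** adj U = V ** real_diag (\<lambda>i. f (e i)) ** adj V"
proof -
  define W where "W = adj V ** U"
  have U1: "adj U ** U = mat 1" "U ** adj U = mat 1"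
    and V1: "adj V ** V = mat 1" "V ** adj V = mat 1"
    using U V by (auto simp: unitary_def)
  have "W ** real_diag d = adj V ** (U ** real_diag d ** adj U) ** U"
    unfolding W_def by (metis U1(1) matrix_mul_assoc matrix_mul_rid)
  also have "\<dots> = real_diag e ** W"
    unfolding W_def eq by (metis V1(1) matrix_mul_assoc matrix_mul_lid)
  finally have comm: "W ** real_diag d = real_diag e ** W" .
  have "W ** real_diag (\<lambda>i. f (d i)) = real_diag (\<lambda>i. f (e i)) ** W"
  proof -
    have "W $ i $ j * complex_of_real (f (d j)) = complex_of_real (f (e i)) * W $ i $ j" for i j
    proof -
      have "W $ i $ j * complex_of_real (d j) = complex_of_real (e i) * W $ i $ j"
        using comm by (metis real_diag_mult_left real_diag_mult_right)
      hence "W $ i $ j = 0 \<or> d j = e i" by simp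
      thus ?thesis by auto
    qed
    thus ?thesis by (simp add: vec_eq_iff real_diag_mult_left real_diag_mult_right)
  qed
  hence "V ** (W ** real_diag (\<lambda>i. f (d i))) ** adj U = V ** (real_diag (\<lambda>i. f (e i)) ** W) ** adj U"
    by simp
  thus ?thesis
    unfolding W_def by (metis U1(2) V1(2) matrix_mul_assoc matrix_mul_lid matrix_mul_rid)
qed

lemma mat_powr_diagonalization:
  assumes "unitary U" "\<And>i. 0 < d i"
  shows "(U ** real_diag d ** adj U) mpowr t = U ** real_diag (\<lambda>i. d i powr t) ** adj U"
  unfolding mat_powr_def
proof (rule the_equality)
  show "\<exists>V e. unitary V \<and> (\<forall>i. 0 < e i) \<and>
      U ** real_diag d ** adj U = V ** real_diag e ** adj V \<and>
      U ** real_diag (\<lambda>i. d i powr t) ** adj U = V ** real_diag (\<lambda>i. e i powr t) ** adj V"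
    using assms by blast
next
  fix X
  assume "\<exists>V e. unitary V \<and> (\<forall>i. 0 < e i) \<and>
      U ** real_diag d ** adj U = V ** real_diag e ** adj V \<and>
      X = V ** real_diag (\<lambda>i. e i powr t) ** adj V"
  then show "X = U ** real_diag (\<lambda>i. d i powr t) ** adj U"
    using unitary_diag_function_unique[OF assms(1), where f = "\<lambda>x. x powr t"] by metis
qed

end

theory Submission
  imports Defs
begin

text \<open>
  With \<open>S = A\<^sup>1\<^sup>/\<^sup>2 V\<close>, where \<open>V\<close> diagonalizes \<open>A\<^sup>-\<^sup>1\<^sup>/\<^sup>2 B A\<^sup>-\<^sup>1\<^sup>/\<^sup>2\<close> with eigenvalues \<open>e\<^sub>i\<close>, one has
  \<open>A #\<^sub>t B = S diag(e\<^sub>i\<^sup>t) S\<^sup>*\<close> for all \<open>t\<close>, in particular for \<open>t = 0, 1\<close>, so the claim reduces to scalars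
  \<open>b = e\<^sub>i\<close>. For convex \<open>f\<close> the sum telescopes: its \<open>j\<close>-th term is the difference at \<open>\<mu>\<close> of the piecewise
  linear interpolants of \<open>f\<close> on the dyadic grids of mesh \<open>2\<^sup>1\<^sup>-\<^sup>j\<close> and \<open>2\<^sup>-\<^sup>j\<close>. Hence it is at most
  \<open>(1 - \<mu>) f(0) + \<mu> f(1) - f(\<mu>)\<close>. Taking \<open>f(t) = b\<^sup>1\<^sup>-\<^sup>t\<^sup>/\<^sup>2\<close> or \<open>f(t) = b\<^sup>t\<^sup>/\<^sup>2\<close>, what remains is
  \<open>2 b\<^sup>1\<^sup>/\<^sup>2 \<le> b\<^sup>\<nu> + b\<^sup>1\<^sup>-\<^sup>\<nu>\<close>. Here \<open>\<mu> = 2\<nu>\<close> in the first case and \<open>\<mu> = 2 - 2\<nu>\<close> in the second.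
\<close>

section \<open>Dyadic interpolation of a convex function\<close>

text \<open>Value at \<open>x\<close> of the piecewise linear interpolant of \<open>f\<close> on the
  grid of multiples of 1 / 2^j. At a grid point the left node is \<open>x\<close> itself and the
  right node has weight 0.\<close>

definition dyadic_interp :: "(real \<Rightarrow> real) \<Rightarrow> nat \<Rightarrow> real \<Rightarrow> real" where
  "dyadic_interp f j x =
     (1 - frac (2 ^ j * x)) * f (of_int \<lfloor>2 ^ j * x\<rfloor> / 2 ^ j)
     + frac (2 ^ j * x) * f ((of_int \<lfloor>2 ^ j * x\<rfloor> + 1) / 2 ^ j)"

text \<open>The point \<open>x\<close> is the convex combination of its two neighbouring grid points
  with weights 1 - \<theta> and \<theta>, so convexity applies directly.\<close>

lemma dyadic_interp_ge:
  assumes "convex_on UNIV f"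
  shows "f x \<le> dyadic_interp f j x"
proof -
  define m where "m = real_of_int \<lfloor>2 ^ j * x\<rfloor>"
  define \<theta> where "\<theta> = frac (2 ^ j * x)"
  have sum: "m + \<theta> = 2 ^ j * x"
    by (simp add: m_def \<theta>_def frac_def)
  have \<theta>: "0 \<le> \<theta>" "\<theta> \<le> 1"
    unfolding \<theta>_def by (simp_all add: frac_lt_1 less_imp_le)
  have "(1 - \<theta>) *\<^sub>R (m / 2 ^ j) + \<theta> *\<^sub>R ((m + 1) / 2 ^ j) = (m + \<theta>) / 2 ^ j"
    by (simp add: field_simps)
  also have "\<dots> = x" unfolding sum by simp
  finally have "f x \<le> (1 - \<theta>) * f (m / 2 ^ j) + \<theta> * f ((m + 1) / 2 ^ j)"
    using convex_onD[OF assms \<theta>, of "m / 2 ^ j" "(m + 1) / 2 ^ j"] by simp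
  then show ?thesis by (simp only: dyadic_interp_def m_def \<theta>_def)
qed

lemma dyadic_interp_0:
  assumes "0 \<le> x" "x \<le> 1"
  shows "dyadic_interp f 0 x = (1 - x) * f 0 + x * f 1"
\<comment> \<open>The endpoint 1 belongs to the next cell: its floor is 1 and its fractional part 0,
  so only \<open>f 1\<close> survives.\<close>
proof (cases "x = 1")
  case False
  with assms have "\<lfloor>x\<rfloor> = 0" by (simp add: floor_eq_iff)
  then show ?thesis by (simp add: dyadic_interp_def frac_def)
qed (simp add: dyadic_interp_def)

text \<open>With \<open>s_coef_odd\<close> this resolves the signs. For j \<ge> 1, an even
  \<open>r_idx\<close> puts 2^(j-1) * x in the lower half of [m, m+1), an odd one in the upper half;
  \<open>s_coef\<close> is the distance to the nearest integer.\<close>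

lemma s_coef_even:
  assumes "r_idx j x = 2 * m"
  shows "s_coef j x = 2 ^ (j - 1) * x - of_int m"
proof -
  have "\<lfloor>(of_int (2 * m) + 1) / 2 :: real\<rfloor> = m"
    by (simp add: floor_eq_iff)
  then show ?thesis
    by (simp add: s_coef_def assms power_int_add)
qed

lemma s_coef_odd:
  assumes "r_idx j x = 2 * m + 1"
  shows "s_coef j x = of_int m + 1 - 2 ^ (j - 1) * x"
proof -
  have "\<lfloor>(of_int (2 * m + 1) + 1) / 2 :: real\<rfloor> = m + 1"
    by (simp add: floor_eq_iff)
  then show ?thesis
    by (simp add: s_coef_def assms power_int_add)
qed

text \<open>On a coarse cell the finer interpolant only adds the midpoint as a node. The difference
  is therefore a tent that vanishes at both ends of the cell; \<open>s_coef\<close> is this tent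
  with height 1/2 and the bracket is twice the convexity gap at the midpoint.\<close>

lemma dyadic_interp_diff:
  fixes j :: nat and x :: real
  defines "m \<equiv> real_of_int (k_idx (Suc j) x)"
  shows "dyadic_interp f j x - dyadic_interp f (Suc j) x =
    s_coef (Suc j) x *
      (f (m / 2 ^ j) + f ((m + 1) / 2 ^ j) - 2 * f ((2 * m + 1) / 2 ^ Suc j))"
proof -
  define y where "y = 2 ^ j * x"
  have m: "m = of_int \<lfloor>y\<rfloor>" by (simp add: m_def k_idx_def y_def)
  have y2: "2 ^ Suc j * x = 2 * y" by (simp add: y_def)
  have half: "f (2 * m / 2 ^ Suc j) = f (m / 2 ^ j)"
    "f ((2 * m + 2) / 2 ^ Suc j) = f ((m + 1) / 2 ^ j)"
    by (rule arg_cong[where f = f], simp add: field_simps)+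
  have fl: "m \<le> y" "y < m + 1"
    unfolding m by linarith+
  have Dj: "dyadic_interp f j x = (1 - (y - m)) * f (m / 2 ^ j) + (y - m) * f ((m + 1) / 2 ^ j)"
    by (simp add: dyadic_interp_def frac_def flip: y_def m)
  show ?thesis
  \<comment> \<open>The half of the coarse cell that contains \<open>x\<close> decides the parity of
    \<open>r_idx\<close> and the fine cell used.\<close>
  proof (cases "2 * y < 2 * m + 1")
    case True
    have r: "\<lfloor>2 * y\<rfloor> = 2 * \<lfloor>y\<rfloor>"
      using True fl by (simp add: m floor_eq_iff)
    then have s: "s_coef (Suc j) x = y - m"
      using s_coef_even[of "Suc j" x "\<lfloor>y\<rfloor>"] by (simp only: r_idx_def y2) (simp add: m y_def)
    have "dyadic_interp f (Suc j) x
        = (1 - 2 * (y - m)) * f (2 * m / 2 ^ Suc j) + 2 * (y - m) * f ((2 * m + 1) / 2 ^ Suc j)"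
      unfolding dyadic_interp_def y2 frac_def r by (simp add: m algebra_simps)
    then show ?thesis unfolding Dj s half by (simp add: algebra_simps)
  next
    case False
    have r: "\<lfloor>2 * y\<rfloor> = 2 * \<lfloor>y\<rfloor> + 1"
      using False fl(2)
      unfolding floor_eq_iff of_int_add of_int_mult of_int_numeral of_int_1 m[symmetric] by linarith
    then have s: "s_coef (Suc j) x = m + 1 - y"
      using s_coef_odd[of "Suc j" x "\<lfloor>y\<rfloor>"] by (simp only: r_idx_def y2) (simp add: m y_def)
    have "dyadic_interp f (Suc j) x
        = (1 - (2 * (y - m) - 1)) * f ((2 * m + 1) / 2 ^ Suc j)
          + (2 * (y - m) - 1) * f ((2 * m + 2) / 2 ^ Suc j)"
      unfolding dyadic_interp_def y2 frac_def r by (simp add: m algebra_simps)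
    then show ?thesis unfolding Dj s half by (simp add: algebra_simps)
  qed
qed

text \<open>The telescoped sum is the chord over [0,1] minus the \<open>N\<close>-th interpolant,
  and the latter lies above \<open>f\<close> for every \<open>N\<close>.\<close>

lemma convex_dyadic_sum_le:
  assumes "convex_on UNIV f" "0 \<le> x" "x \<le> 1"
  shows "(\<Sum>j=1..N. s_coef j x *
      (f (of_int (k_idx j x) / 2 ^ (j - 1)) + f ((of_int (k_idx j x) + 1) / 2 ^ (j - 1))
       - 2 * f ((2 * of_int (k_idx j x) + 1) / 2 ^ j)))
    \<le> (1 - x) * f 0 + x * f 1 - f x"
proof -
  have "(\<Sum>j=1..N. s_coef j x *
      (f (of_int (k_idx j x) / 2 ^ (j - 1)) + f ((of_int (k_idx j x) + 1) / 2 ^ (j - 1))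
       - 2 * f ((2 * of_int (k_idx j x) + 1) / 2 ^ j)))
    = (\<Sum>j<N. dyadic_interp f j x - dyadic_interp f (Suc j) x)"
    unfolding dyadic_interp_diff
    by (rule sum.reindex_bij_witness[of _ Suc "\<lambda>j. j - 1"]) auto
  also have "\<dots> = dyadic_interp f 0 x - dyadic_interp f N x"
    by (rule sum_lessThan_telescope')
  finally show ?thesis
    using dyadic_interp_ge[OF assms(1), of x N] dyadic_interp_0[OF assms(2,3), of f] by simp
qed

section \<open>Scalar inequalities\<close>

text \<open>This is exp composed with an affine function of \<open>t\<close>. The parameters cover
  both cases: \<open>p = 1\<close>, \<open>q = -1/2\<close> and \<open>p = 0\<close>,
  \<open>q = 1/2\<close>.\<close>

lemma convex_on_powr_exponent:
  fixes b :: real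
  assumes "0 < b"
  shows "convex_on UNIV (\<lambda>t. b powr (p + q * t))"
proof (rule convex_onI)
  fix t x y :: real
  assume t: "0 < t" "t < 1"
  have "exp ((1 - t) *\<^sub>R ((p + q * x) * ln b) + t *\<^sub>R ((p + q * y) * ln b))
      \<le> (1 - t) * exp ((p + q * x) * ln b) + t * exp ((p + q * y) * ln b)"
    using t by (intro convex_onD[OF exp_convex]) auto
  then show "b powr (p + q * ((1 - t) *\<^sub>R x + t *\<^sub>R y))
      \<le> (1 - t) * b powr (p + q * x) + t * b powr (p + q * y)"
    using assms by (simp add: powr_def algebra_simps)
qed simp

text \<open>Arithmetic-geometric mean inequality for two powers with product \<open>b\<close>,
  obtained by expanding the square of the difference of their roots.\<close>

lemma powr_complement_ge:
  fixes b :: real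
  assumes "0 < b"
  shows "2 * b powr (1/2) \<le> b powr t + b powr (1 - t)"
proof -
  have "b powr (1/2) = b powr (t/2) * b powr ((1 - t)/2)"
    by (simp flip: powr_add add: field_simps)
  moreover have "b powr t = (b powr (t/2))\<^sup>2" "b powr (1 - t) = (b powr ((1 - t)/2))\<^sup>2"
    by (simp_all add: power2_eq_square flip: powr_add)
  ultimately show ?thesis
    using zero_le_power2[of "b powr (t/2) - b powr ((1 - t)/2)"]
    by (simp add: power2_eq_square algebra_simps)
qed

lemma scalar_refined_young_lower:
  fixes b :: real
  assumes b: "0 < b" and \<nu>: "0 \<le> \<nu>" "\<nu> \<le> 1/2"
  shows "1 - \<nu> + \<nu> * b + (\<Sum>j=1..N. s_coef j (2 * \<nu>) *
      (b powr (1 - beta_exp j \<nu>) + b powr (1 - 2 powi (- int j) - beta_exp j \<nu>)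
       - 2 * b powr (1 - 2 powi (- int j - 1) - beta_exp j \<nu>)))
    \<le> b powr \<nu> + 2 * (1 - \<nu>) * ((1 + b) / 2 - b powr (1/2))"
    (is "_ + ?S \<le> _")
proof -
  \<comment> \<open>This \<open>?f\<close> runs from \<open>b\<close> at 0 to the square root of
    \<open>b\<close> at 1. Halving a node and subtracting it from 1 gives the exponents of the
    claim.\<close>
  let ?f = "\<lambda>t. b powr (1 + (- 1/2) * t)"
  have "(\<Sum>j=1..N. s_coef j (2 * \<nu>) *
      (b powr (1 - beta_exp j \<nu>) + b powr (1 - 2 powi (- int j) - beta_exp j \<nu>)
       - 2 * b powr (1 - 2 powi (- int j - 1) - beta_exp j \<nu>)))
    = (\<Sum>j=1..N. s_coef j (2 * \<nu>) *
      (?f (of_int (k_idx j (2 * \<nu>)) / 2 ^ (j - 1)) + ?f ((of_int (k_idx j (2 * \<nu>)) + 1) / 2 ^ (j - 1))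
       - 2 * ?f ((2 * of_int (k_idx j (2 * \<nu>)) + 1) / 2 ^ j)))"
  proof (rule sum.cong[OF refl])
    fix j assume "j \<in> {1..N}"
    \<comment> \<open>Writing \<open>j\<close> as a successor removes the truncated subtraction in
      \<open>2 ^ (j - 1)\<close>.\<close>
    then obtain i where j: "j = Suc i" by (cases j) auto
    define m where "m = real_of_int (k_idx j (2 * \<nu>))"
    have p: "(2::real) powi (- int j) = 1 / (2 * 2 ^ i)" "(2::real) powi (- int j - 1) = 1 / (4 * 2 ^ i)"
      by (simp_all add: j power_int_minus power_int_diff power_int_add field_simps)
    have "1 - beta_exp j \<nu> = 1 + (- 1/2) * (m / 2 ^ (j - 1))"
      "1 - 2 powi (- int j) - beta_exp j \<nu> = 1 + (- 1/2) * ((m + 1) / 2 ^ (j - 1))"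
      "1 - 2 powi (- int j - 1) - beta_exp j \<nu> = 1 + (- 1/2) * ((2 * m + 1) / 2 ^ j)"
      unfolding beta_exp_def m_def[symmetric] p by (simp_all add: j field_simps)
    then show "s_coef j (2 * \<nu>) *
      (b powr (1 - beta_exp j \<nu>) + b powr (1 - 2 powi (- int j) - beta_exp j \<nu>)
       - 2 * b powr (1 - 2 powi (- int j - 1) - beta_exp j \<nu>))
      = s_coef j (2 * \<nu>) *
      (?f (of_int (k_idx j (2 * \<nu>)) / 2 ^ (j - 1)) + ?f ((of_int (k_idx j (2 * \<nu>)) + 1) / 2 ^ (j - 1))
       - 2 * ?f ((2 * of_int (k_idx j (2 * \<nu>)) + 1) / 2 ^ j))"
      by (simp only: m_def)
  qed
  also have "\<dots> \<le> (1 - 2 * \<nu>) * ?f 0 + 2 * \<nu> * ?f 1 - ?f (2 * \<nu>)"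
    using \<nu> by (intro convex_dyadic_sum_le convex_on_powr_exponent b) auto
  finally have "?S \<le> (1 - 2 * \<nu>) * b + 2 * \<nu> * b powr (1/2) - b powr (1 - \<nu>)"
    using b by simp
  \<comment> \<open>The right side minus the left is exactly b^\<nu> + b^(1-\<nu>) - 2
    b^(1/2).\<close>
  moreover have "1 - \<nu> + \<nu> * b + ((1 - 2 * \<nu>) * b + 2 * \<nu> * b powr (1/2) - b powr (1 - \<nu>))
      \<le> b powr \<nu> + 2 * (1 - \<nu>) * ((1 + b) / 2 - b powr (1/2))"
    using powr_complement_ge[OF b, of \<nu>] by (simp add: field_simps)
  ultimately show ?thesis by linarith
qed

lemma scalar_refined_young_upper:
  fixes b :: real
  assumes b: "0 < b" and \<nu>: "1/2 \<le> \<nu>" "\<nu> \<le> 1"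
  shows "1 - \<nu> + \<nu> * b + (\<Sum>j=1..N. s_coef j (2 - 2 * \<nu>) *
      (b powr (gamma_exp j \<nu>) + b powr (gamma_exp j \<nu> + 2 powi (- int j))
       - 2 * b powr (gamma_exp j \<nu> + 2 powi (- int j - 1))))
    \<le> b powr \<nu> + 2 * \<nu> * ((1 + b) / 2 - b powr (1/2))"
    (is "_ + ?S \<le> _")
proof -
  \<comment> \<open>Now \<open>?f\<close> starts at 1 and again ends at the square root of
    \<open>b\<close>; its value at 2 - 2\<nu> is once more b^(1-\<nu>). The summand 0 keeps the
    shape of \<open>convex_on_powr_exponent\<close>.\<close>
  let ?f = "\<lambda>t. b powr (0 + (1/2) * t)"
  have "(\<Sum>j=1..N. s_coef j (2 - 2 * \<nu>) *
      (b powr (gamma_exp j \<nu>) + b powr (gamma_exp j \<nu> + 2 powi (- int j))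
       - 2 * b powr (gamma_exp j \<nu> + 2 powi (- int j - 1))))
    = (\<Sum>j=1..N. s_coef j (2 - 2 * \<nu>) *
      (?f (of_int (k_idx j (2 - 2 * \<nu>)) / 2 ^ (j - 1))
       + ?f ((of_int (k_idx j (2 - 2 * \<nu>)) + 1) / 2 ^ (j - 1))
       - 2 * ?f ((2 * of_int (k_idx j (2 - 2 * \<nu>)) + 1) / 2 ^ j)))"
  proof (rule sum.cong[OF refl])
    fix j assume "j \<in> {1..N}"
    then obtain i where j: "j = Suc i" by (cases j) auto
    define m where "m = real_of_int (k_idx j (2 - 2 * \<nu>))"
    have p: "(2::real) powi (- int j) = 1 / (2 * 2 ^ i)" "(2::real) powi (- int j - 1) = 1 / (4 * 2 ^ i)"
      by (simp_all add: j power_int_minus power_int_diff power_int_add field_simps)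
    have "gamma_exp j \<nu> = 0 + (1/2) * (m / 2 ^ (j - 1))"
      "gamma_exp j \<nu> + 2 powi (- int j) = 0 + (1/2) * ((m + 1) / 2 ^ (j - 1))"
      "gamma_exp j \<nu> + 2 powi (- int j - 1) = 0 + (1/2) * ((2 * m + 1) / 2 ^ j)"
      unfolding gamma_exp_def m_def[symmetric] p by (simp_all add: j field_simps)
    then show "s_coef j (2 - 2 * \<nu>) *
      (b powr (gamma_exp j \<nu>) + b powr (gamma_exp j \<nu> + 2 powi (- int j))
       - 2 * b powr (gamma_exp j \<nu> + 2 powi (- int j - 1)))
      = s_coef j (2 - 2 * \<nu>) *
      (?f (of_int (k_idx j (2 - 2 * \<nu>)) / 2 ^ (j - 1))
       + ?f ((of_int (k_idx j (2 - 2 * \<nu>)) + 1) / 2 ^ (j - 1))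
       - 2 * ?f ((2 * of_int (k_idx j (2 - 2 * \<nu>)) + 1) / 2 ^ j))"
      by (simp only: m_def)
  qed
  also have "\<dots> \<le> (1 - (2 - 2 * \<nu>)) * ?f 0 + (2 - 2 * \<nu>) * ?f 1 - ?f (2 - 2 * \<nu>)"
    using \<nu> by (intro convex_dyadic_sum_le convex_on_powr_exponent b) auto
  finally have "?S \<le> 2 * \<nu> - 1 + (2 - 2 * \<nu>) * b powr (1/2) - b powr (1 - \<nu>)"
    using b by (simp add: diff_divide_distrib)
  moreover have "1 - \<nu> + \<nu> * b + (2 * \<nu> - 1 + (2 - 2 * \<nu>) * b powr (1/2) - b powr (1 - \<nu>))
      \<le> b powr \<nu> + 2 * \<nu> * ((1 + b) / 2 - b powr (1/2))"
    using powr_complement_ge[OF b, of \<nu>] by (simp add: field_simps)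
  ultimately show ?thesis by linarith
qed

section \<open>Adjoints and the complex inner product\<close>

lemma adj_nth: "adj A $ i $ j = cnj (A $ j $ i)"
  by (simp add: adj_def)

lemma adj_adj: "adj (adj A) = A"
  by (simp add: adj_def vec_eq_iff)

lemma adj_mult: "adj (A ** B) = adj B ** adj A"
  by (simp add: adj_def matrix_matrix_mult_def vec_eq_iff mult.commute)

lemma adj_real_diag: "adj (real_diag d) = real_diag d"
  by (simp add: adj_def real_diag_def vec_eq_iff)

text \<open>Conjugate-linear in the first argument, to agree with \<open>quad_form\<close>. Its real
  part is the Euclidean inner product \<bullet>, which supplies compactness and dimension
  arguments.\<close>

definition cinner :: "complex^'n \<Rightarrow> complex^'n \<Rightarrow> complex" where
  "cinner x y = (\<Sum>i\<in>UNIV. cnj (x $ i) * y $ i)"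

lemma quad_form_cinner: "quad_form A x = cinner x (A *v x)"
  by (simp add: quad_form_def cinner_def)

lemma cinner_add_right: "cinner x (y + z) = cinner x y + cinner x z"
  by (simp add: cinner_def distrib_left sum.distrib)

lemma cinner_smult_right: "cinner x (c *s y) = c * cinner x y"
  by (simp add: cinner_def sum_distrib_left mult_ac)

lemma cinner_smult_left: "cinner (c *s x) y = cnj c * cinner x y"
  by (simp add: cinner_def sum_distrib_left mult_ac)

lemma cinner_scaleR_right: "cinner x (c *\<^sub>R y) = of_real c * cinner x y"
  by (simp add: cinner_def sum_distrib_left scaleR_conv_of_real[of _ "_ :: complex"] mult_ac)

lemma cnj_cinner: "cnj (cinner x y) = cinner y x"
  by (simp add: cinner_def mult.commute)

lemma inner_eq_Re_cinner: "x \<bullet> y = Re (cinner x y)"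
  by (simp add: inner_vec_def cinner_def inner_complex_def)

lemma cinner_self: "cinner x x = of_real ((norm x)\<^sup>2)"
proof (rule complex_eqI)
  show "Re (cinner x x) = Re (of_real ((norm x)\<^sup>2))"
    by (simp add: power2_norm_eq_inner inner_eq_Re_cinner)
  show "Im (cinner x x) = Im (of_real ((norm x)\<^sup>2))"
    by (simp add: cinner_def mult.commute)
qed

lemma cinner_adj: "cinner x (A *v y) = cinner (adj A *v x) y"
proof -
  have "cinner x (A *v y) = (\<Sum>i\<in>UNIV. \<Sum>j\<in>UNIV. cnj (x $ i) * (A $ i $ j * y $ j))"
    by (simp add: cinner_def matrix_vector_mult_def sum_distrib_left)
  also have "\<dots> = (\<Sum>j\<in>UNIV. \<Sum>i\<in>UNIV. cnj (x $ i) * (A $ i $ j * y $ j))"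
    by (rule sum.swap)
  also have "\<dots> = cinner (adj A *v x) y"
    by (simp add: cinner_def matrix_vector_mult_def adj_nth sum_distrib_left sum_distrib_right mult_ac)
  finally show ?thesis .
qed

lemma cinner_hermitian: "hermitian A \<Longrightarrow> cinner x (A *v y) = cinner (A *v x) y"
  by (simp add: cinner_adj hermitian_def)

lemma matrix_vector_mult_scaleR_right:
  fixes A :: "complex^'n^'m"
  shows "A *v (c *\<^sub>R x) = c *\<^sub>R (A *v x)"
  by (simp add: vec_eq_iff matrix_vector_mult_def scaleR_sum_right)

lemma inner_hermitian: "hermitian A \<Longrightarrow> x \<bullet> (A *v y) = (A *v x) \<bullet> y"
  by (simp add: inner_eq_Re_cinner cinner_hermitian)

section \<open>Spectral theorem for Hermitian matrices\<close>

text \<open>The eigenvector is a maximizer of the Rayleigh quotient on the invariant subspace.\<close>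

lemma hermitian_eigenvector_in_subspace:
  fixes A :: "complex^'n^'n"
  assumes herm: "hermitian A" and S: "subspace S"
    and inv: "\<And>x. x \<in> S \<Longrightarrow> A *v x \<in> S" and nz: "z \<in> S" "z \<noteq> 0"
  obtains v l where "v \<in> S" "norm v = 1" "A *v v = complex_of_real l *s v"
proof -
  let ?q = "\<lambda>x. x \<bullet> (A *v x)"
  have "compact (sphere 0 1 \<inter> S)"
    by (intro compact_Int_closed closed_subspace S) simp
  moreover have "(1 / norm z) *\<^sub>R z \<in> sphere 0 1 \<inter> S"
    using nz subspace_scale[OF S] by simp
  moreover have "continuous_on (sphere 0 1 \<inter> S) ?q"
    by (intro continuous_intros linear_continuous_on linear_linear[THEN iffD2] linearI)
      (simp_all add: matrix_vector_right_distrib matrix_vector_mult_scaleR_right)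
  ultimately obtain v where v: "v \<in> sphere 0 1 \<inter> S" and max: "\<And>y. y \<in> sphere 0 1 \<inter> S \<Longrightarrow> ?q y \<le> ?q v"
    using continuous_attains_sup[of "sphere 0 1 \<inter> S" ?q] by blast
  define l where "l = ?q v"
  have vS: "v \<in> S" "norm v = 1" using v by auto
  have bound: "?q y \<le> l * (y \<bullet> y)" if "y \<in> S" for y
  proof (cases "y = 0")
    case False
    have "(1 / norm y) *\<^sub>R y \<in> sphere 0 1 \<inter> S"
      using False subspace_scale[OF S that] by simp
    from max[OF this] have "?q y / (norm y)\<^sup>2 \<le> l"
      by (simp add: l_def matrix_vector_mult_scaleR_right power2_eq_square)
    then show ?thesis
      using False by (simp add: divide_le_eq power2_norm_eq_inner)
  qed simp
  \<comment> \<open>The residual of the eigenvalue equation. It stays in \<open>S\<close>, so it is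
    an admissible direction in which to perturb the maximizer.\<close>
  define w where "w = A *v v - l *\<^sub>R v"
  have wS: "w \<in> S"
    unfolding w_def using vS inv S by (intro subspace_diff subspace_scale) auto
  define c where "c = l * (w \<bullet> w) - ?q w"
  have quad: "0 \<le> - 2 * t * (w \<bullet> w) + t\<^sup>2 * c" for t :: real
  proof -
    have "v + t *\<^sub>R w \<in> S"
      using vS wS S by (intro subspace_add subspace_scale) auto
    from bound[OF this] have "0 \<le> l * ((v + t *\<^sub>R w) \<bullet> (v + t *\<^sub>R w)) - ?q (v + t *\<^sub>R w)"
      by simp
    also have "\<dots> = l * (v \<bullet> v) - l + 2 * t * (l * (v \<bullet> w) - w \<bullet> (A *v v)) + t\<^sup>2 * c"
      using inner_hermitian[OF herm, of v w]
      by (simp add: c_def l_def matrix_vector_right_distrib matrix_vector_mult_scaleR_right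
          inner_add_left inner_add_right inner_commute power2_eq_square algebra_simps)
    also have "l * (v \<bullet> w) - w \<bullet> (A *v v) = - (w \<bullet> w)"
      by (simp add: w_def inner_diff_left inner_diff_right inner_commute algebra_simps)
    also have "v \<bullet> v = 1"
      using vS by (simp add: dot_square_norm)
    finally show ?thesis by simp
  qed
  have "w \<bullet> w = 0"
  proof (rule ccontr)
    assume "w \<bullet> w \<noteq> 0"
    then have ww: "0 < w \<bullet> w" by (simp add: inner_gt_zero_iff)
    show False
    \<comment> \<open>The quadratic in \<open>t\<close> has no constant term and slope -2 (w
      \<bullet> w) at 0, so it becomes negative: at 1 if c \<le> 0, otherwise at its minimizer (w
      \<bullet> w) / c.\<close>
    proof (cases "c \<le> 0")
      case True
      with quad[of 1] ww show False by simp
    next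
      case False
      then have "- 2 * ((w \<bullet> w) / c) * (w \<bullet> w) + ((w \<bullet> w) / c)\<^sup>2 * c = - ((w \<bullet> w)\<^sup>2 / c)"
        by (simp add: power2_eq_square field_simps)
      moreover have "0 < (w \<bullet> w)\<^sup>2 / c"
        using False ww by (intro divide_pos_pos zero_less_power) auto
      ultimately show False
        using quad[of "(w \<bullet> w) / c"] by linarith
    qed
  qed
  then have "A *v v = complex_of_real l *s v"
    by (simp add: w_def vec_eq_iff scaleR_conv_of_real[of _ "_ :: complex"])
  with vS that show ?thesis by blast
qed

text \<open>Induction over the index set: the orthogonal complement of the eigenvectors found so far
  is invariant under \<open>A\<close>, and it is nonzero while an index is missing, so it contains a
  further eigenvector.\<close>

lemma hermitian_orthonormal_eigenvectors:
  fixes A :: "complex^'n^'n" and I :: "'n set"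
  assumes herm: "hermitian A"
  shows "\<exists>u d. \<forall>i\<in>I. A *v u i = complex_of_real (d i) *s u i
    \<and> (\<forall>j\<in>I. cinner (u i) (u j) = (if i = j then 1 else 0))"
proof (induction I rule: finite_induct[OF finite])
  case (2 k I)
  then obtain u d where eig: "\<And>i. i \<in> I \<Longrightarrow> A *v u i = complex_of_real (d i) *s u i"
    and orth: "\<And>i j. i \<in> I \<Longrightarrow> j \<in> I \<Longrightarrow> cinner (u i) (u j) = (if i = j then 1 else 0)"
    by metis
  let ?S = "{x. \<forall>i\<in>I. cinner (u i) x = 0}"
  \<comment> \<open>Dimensions here are real. Orthogonality under \<bullet> to both u_i and \<i> u_i
    kills the real and the imaginary part of \<open>cinner\<close>, and these at most 2 |I| vectors
    cannot span the real dimension 2 n.\<close>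
  let ?T = "u ` I \<union> (\<lambda>i. \<i> *s u i) ` I"
  have "dim ?T \<le> card ?T"
    by (rule dim_le_card') (simp add: finite)
  also have "\<dots> \<le> card (u ` I) + card ((\<lambda>i. \<i> *s u i) ` I)"
    by (rule card_Un_le)
  also have "\<dots> \<le> card I + card I"
    by (intro add_mono card_image_le) simp_all
  also have "card I < CARD('n)"
    using 2 by (intro psubset_card_mono) auto
  finally have "dim ?T < DIM(complex^'n)"
    using \<open>card I < CARD('n)\<close> by simp
  then obtain z where z: "z \<noteq> 0" "\<And>y. y \<in> span ?T \<Longrightarrow> orthogonal z y"
    using orthogonal_to_subspace_exists by blast
  have "cinner (u i) z = 0" if "i \<in> I" for i
  proof (rule complex_eqI)
    have "z \<bullet> u i = 0" "z \<bullet> (\<i> *s u i) = 0"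
      using z(2)[OF span_base] that by (auto simp: orthogonal_def)
    then show "Re (cinner (u i) z) = Re 0" "Im (cinner (u i) z) = Im 0"
      by (simp_all add: inner_eq_Re_cinner cinner_smult_right flip: cnj_cinner[of z])
  qed
  then have zS: "z \<in> ?S" by simp
  have "subspace ?S"
    by (auto simp: subspace_def cinner_add_right cinner_scaleR_right) (simp add: cinner_def)
  moreover have "A *v x \<in> ?S" if "x \<in> ?S" for x
    using that by (auto simp: cinner_hermitian[OF herm] eig cinner_smult_left)
  ultimately obtain v l where v: "v \<in> ?S" "norm v = 1" "A *v v = complex_of_real l *s v"
    using hermitian_eigenvector_in_subspace[OF herm _ _ zS z(1)] by blast
  have uv: "cinner (u i) v = 0" "cinner v (u i) = 0" if "i \<in> I" for i
    using v(1) that cnj_cinner[of "u i" v] by auto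
  have vv: "cinner v v = 1"
    using v(2) by (simp add: cinner_self)
  show ?case
    using eig orth v(3) uv vv \<open>k \<notin> I\<close>
    by (intro exI[of _ "u(k := v)"] exI[of _ "d(k := l)"]) auto
qed simp

theorem hermitian_diagonalization:
  fixes A :: "complex^'n^'n"
  assumes "hermitian A"
  obtains U d where "unitary U" "A = U ** real_diag d ** adj U"
proof -
  obtain u and d :: "'n \<Rightarrow> real" where eig: "\<And>i. A *v u i = complex_of_real (d i) *s u i"
    and orth: "\<And>i j. cinner (u i) (u j) = (if i = j then 1 else 0)"
    using hermitian_orthonormal_eigenvectors[OF assms, of UNIV] unfolding ball_UNIV by blast
  \<comment> \<open>The eigenvectors become the columns of \<open>U\<close>.\<close>
  define U where "U = (\<chi> r c. u c $ r)"
  have UU: "adj U ** U = mat 1"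
    using orth by (simp add: vec_eq_iff U_def adj_nth matrix_matrix_mult_def mat_def cinner_def)
  then have U: "unitary U"
    by (simp add: unitary_def matrix_left_right_inverse)
  have "A ** U = U ** real_diag d"
  proof -
    have "(A ** U) $ i $ j = (A *v u j) $ i" for i j
      by (simp add: matrix_matrix_mult_def matrix_vector_mult_def U_def)
    then show ?thesis
      by (simp add: vec_eq_iff real_diag_mult_right eig U_def mult.commute)
  qed
  then have "A = U ** real_diag d ** adj U"
    using U by (metis unitary_def matrix_mul_assoc matrix_mul_rid)
  with U that show ?thesis by blast
qed

section \<open>Congruence and positivity\<close>

lemma real_diag_mult_vec: "(real_diag d *v x) $ i = complex_of_real (d i) * x $ i"
  by (simp add: real_diag_def matrix_vector_mult_def if_distrib if_distribR sum.If_cases cong: if_cong)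

lemma quad_form_congruence: "quad_form (S ** M ** adj S) x = quad_form M (adj S *v x)"
  by (simp add: quad_form_cinner cinner_adj flip: matrix_vector_mul_assoc)

lemma quad_form_real_diag: "quad_form (real_diag d) x = of_real (\<Sum>i\<in>UNIV. d i * (cmod (x $ i))\<^sup>2)"
  by (simp add: quad_form_def real_diag_mult_vec complex_norm_square mult_ac del: of_real_power)

lemma hermitian_congruence: "hermitian M \<Longrightarrow> hermitian (S ** M ** adj S)"
  by (simp add: hermitian_def adj_mult adj_adj matrix_mul_assoc)

lemma pos_semidef_congruence_real_diag:
  assumes "\<And>i. 0 \<le> d i"
  shows "pos_semidef (S ** real_diag d ** adj S)"
  unfolding pos_semidef_def
proof
  show "hermitian (S ** real_diag d ** adj S)"
    by (intro hermitian_congruence) (simp add: hermitian_def adj_real_diag)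
qed (simp add: quad_form_congruence quad_form_real_diag assms sum_nonneg del: of_real_sum)

lemma pos_def_congruence:
  assumes "pos_def M" and "\<And>x. adj S *v x = 0 \<Longrightarrow> x = 0"
  shows "pos_def (S ** M ** adj S)"
  using assms by (auto simp: pos_def_def hermitian_congruence quad_form_congruence)

theorem pos_def_diagonalization:
  fixes A :: "complex^'n^'n"
  assumes "pos_def A"
  obtains U d where "unitary U" "\<And>i. 0 < d i" "A = U ** real_diag d ** adj U"
proof -
  obtain U d where U: "unitary U" and A: "A = U ** real_diag d ** adj U"
    using assms hermitian_diagonalization unfolding pos_def_def by blast
  have "0 < d i" for i
  proof -
    \<comment> \<open>The form is tested on the \<open>i\<close>-th column of \<open>U\<close>,
      where its value is the eigenvalue \<open>d i\<close>.\<close>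
    have ax: "adj U *v (U *v axis i 1) = axis i 1"
      using U by (simp add: unitary_def matrix_vector_mul_assoc)
    then have "U *v axis i 1 \<noteq> 0"
      by (metis axis_eq_0_iff matrix_vector_mult_0_right zero_neq_one)
    then have "0 < Re (quad_form A (U *v axis i 1))"
      using assms by (simp add: pos_def_def)
    also have "\<dots> = (\<Sum>j\<in>UNIV. if j = i then d j else 0)"
      unfolding A quad_form_congruence ax quad_form_real_diag Re_complex_of_real
      by (intro sum.cong) (auto simp: axis_def)
    finally show ?thesis by simp
  qed
  with U A that show ?thesis by blast
qed

section \<open>Matrix powers and simultaneous diagonalization\<close>

lemma real_diag_mult: "real_diag d ** real_diag e = real_diag (\<lambda>i. d i * e i)"
  by (simp add: vec_eq_iff real_diag_mult_left) (simp add: real_diag_def)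

lemma real_diag_1: "real_diag (\<lambda>i. 1) = mat 1"
  by (simp add: real_diag_def mat_def vec_eq_iff)

text \<open>One \<open>U\<close> diagonalizes all powers of \<open>A\<close>, so the exponents add
  on the diagonal.\<close>

lemma mat_powr_add:
  assumes "unitary U" "\<And>i. 0 < d i" and A: "A = U ** real_diag d ** adj U"
  shows "(A mpowr s) ** (A mpowr t) = A mpowr (s + t)"
proof -
  have "(A mpowr s) ** (A mpowr t)
      = U ** real_diag (\<lambda>i. d i powr s) ** (adj U ** U) ** real_diag (\<lambda>i. d i powr t) ** adj U"
    by (simp add: A mat_powr_diagonalization assms(1,2) matrix_mul_assoc)
  also have "\<dots> = U ** (real_diag (\<lambda>i. d i powr s) ** real_diag (\<lambda>i. d i powr t)) ** adj U"
    using assms(1) by (simp add: unitary_def matrix_mul_assoc)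
  finally show ?thesis
    by (simp add: real_diag_mult A mat_powr_diagonalization assms(1,2) powr_add)
qed

lemma gmean_simultaneous_diagonalization:
  fixes A B :: "complex^'n^'n"
  assumes "pos_def A" "pos_def B"
  obtains S e where "\<And>i. 0 < e i"
    "A = S ** real_diag (\<lambda>i. 1) ** adj S" "B = S ** real_diag e ** adj S"
    "\<And>t. gmean t A B = S ** real_diag (\<lambda>i. e i powr t) ** adj S"
proof -
  obtain U d where U: "unitary U" "\<And>i. 0 < d i" and A: "A = U ** real_diag d ** adj U"
    using pos_def_diagonalization[OF assms(1)] by blast
  define P where "P = A mpowr (- 1/2)"
  define Q where "Q = A mpowr (1/2)"
  have A0: "A mpowr 0 = mat 1" and A1: "A mpowr 1 = A"
    using U by (simp_all add: A mat_powr_diagonalization less_imp_neq[THEN not_sym] less_imp_le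
        real_diag_1 unitary_def)
  have PQ: "P ** Q = mat 1" "Q ** P = mat 1" "Q ** Q = A"
    unfolding P_def Q_def mat_powr_add[OF U A] by (simp_all add: A0 A1)
  have adjPQ: "adj P = P" "adj Q = Q"
    using U by (simp_all add: P_def Q_def A mat_powr_diagonalization adj_mult adj_adj
        adj_real_diag matrix_mul_assoc)
  \<comment> \<open>\<open>P\<close> is self-adjoint with inverse \<open>Q\<close>, hence
    \<open>adj P\<close> is injective.\<close>
  have "x = 0" if "adj P *v x = 0" for x
    using that PQ(2) adjPQ
    by (metis matrix_vector_mul_assoc matrix_vector_mul_lid matrix_vector_mult_0_right)
  then have "pos_def (P ** B ** P)"
    using pos_def_congruence[OF assms(2), of P] adjPQ by simp
  then obtain V e where V: "unitary V" "\<And>i. 0 < e i" and C: "P ** B ** P = V ** real_diag e ** adj V"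
    using pos_def_diagonalization by blast
  define S where "S = Q ** V"
  have "adj S = adj V ** Q" by (simp add: S_def adj_mult adjPQ)
  then have S: "S ** M ** adj S = Q ** (V ** M ** adj V) ** Q" for M
    by (simp add: S_def matrix_mul_assoc)
  show thesis
  proof
    show "0 < e i" for i by (rule V)
    show "A = S ** real_diag (\<lambda>i. 1) ** adj S"
      unfolding S using V(1) PQ(3) by (simp add: real_diag_1 unitary_def)
    have "S ** real_diag e ** adj S = (Q ** P) ** B ** (P ** Q)"
      unfolding S C[symmetric] by (simp add: matrix_mul_assoc)
    then show "B = S ** real_diag e ** adj S"
      by (simp add: PQ)
    show "gmean t A B = S ** real_diag (\<lambda>i. e i powr t) ** adj S" for t
      unfolding gmean_def P_def[symmetric] Q_def[symmetric] C mat_powr_diagonalization[OF V] S ..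
  qed
qed

section \<open>Reduction of the matrix inequality to scalars\<close>

text \<open>For fixed \<open>S\<close> this is real-linear and monotone in \<open>d\<close>, so a
  linear combination of means collapses to a single diagonal.\<close>

definition diag_congr :: "complex^'n^'n \<Rightarrow> ('n \<Rightarrow> real) \<Rightarrow> complex^'n^'n" where
  "diag_congr S d = S ** real_diag d ** adj S"

lemma diag_congr_nth:
  "diag_congr S d $ i $ j = (\<Sum>k\<in>UNIV. d k *\<^sub>R (S $ i $ k * cnj (S $ j $ k)))"
proof -
  have "diag_congr S d $ i $ j = (\<Sum>k\<in>UNIV. (S ** real_diag d) $ i $ k * adj S $ k $ j)"
    by (simp add: diag_congr_def matrix_matrix_mult_def)
  then show ?thesis
    by (simp add: real_diag_mult_right adj_nth scaleR_conv_of_real mult_ac)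
qed

lemma diag_congr_add: "diag_congr S d + diag_congr S e = diag_congr S (\<lambda>i. d i + e i)"
  by (simp add: vec_eq_iff diag_congr_nth scaleR_add_left sum.distrib)

lemma diag_congr_diff: "diag_congr S d - diag_congr S e = diag_congr S (\<lambda>i. d i - e i)"
  by (simp add: vec_eq_iff diag_congr_nth scaleR_diff_left sum_subtractf)

lemma diag_congr_scaleR: "c *\<^sub>R diag_congr S d = diag_congr S (\<lambda>i. c * d i)"
  by (simp add: vec_eq_iff diag_congr_nth scaleR_sum_right)

lemma diag_congr_sum: "(\<Sum>j\<in>J. diag_congr S (d j)) = diag_congr S (\<lambda>i. \<Sum>j\<in>J. d j i)"
proof (induction J rule: infinite_finite_induct)
  case (insert j J)
  then show ?case by (simp add: diag_congr_add)
qed (simp_all add: vec_eq_iff diag_congr_nth)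

lemma diag_congr_mono: "(\<And>i. d i \<le> e i) \<Longrightarrow> diag_congr S d \<le>\<^sub>L diag_congr S e"
  unfolding loewner_le_def diag_congr_diff
  by (simp add: diag_congr_def pos_semidef_congruence_real_diag)

theorem theorem4p2:
  fixes A B :: "complex^'n^'n" and N :: nat and \<nu> :: real
  assumes "pos_def A" and "pos_def B"
  shows "(0 \<le> \<nu> \<and> \<nu> \<le> 1/2 \<longrightarrow>
      amean \<nu> A B
      + (\<Sum>j=1..N. s_coef j (2 * \<nu>) *\<^sub>R
          (gmean (1 - beta_exp j \<nu>) A B
           + gmean (1 - 2 powi (- int j) - beta_exp j \<nu>) A B
           - 2 *\<^sub>R gmean (1 - 2 powi (- int j - 1) - beta_exp j \<nu>) A B))
      \<le>\<^sub>L gmean \<nu> A B + (2 * (1 - \<nu>)) *\<^sub>R (amean (1/2) A B - gmean (1/2) A B))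
    \<and>
    (1/2 \<le> \<nu> \<and> \<nu> \<le> 1 \<longrightarrow>
      amean \<nu> A B
      + (\<Sum>j=1..N. s_coef j (2 - 2 * \<nu>) *\<^sub>R
          (gmean (gamma_exp j \<nu>) A B
           + gmean (gamma_exp j \<nu> + 2 powi (- int j)) A B
           - 2 *\<^sub>R gmean (gamma_exp j \<nu> + 2 powi (- int j - 1)) A B))
      \<le>\<^sub>L gmean \<nu> A B + (2 * \<nu>) *\<^sub>R (amean (1/2) A B - gmean (1/2) A B))"
proof -
  obtain S e where e: "\<And>i. 0 < e i"
    and "A = S ** real_diag (\<lambda>i. 1) ** adj S" "B = S ** real_diag e ** adj S"
    and "\<And>t. gmean t A B = S ** real_diag (\<lambda>i. e i powr t) ** adj S"
    using gmean_simultaneous_diagonalization[OF assms] by blast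
  then have A: "A = diag_congr S (\<lambda>i. 1)" and B: "B = diag_congr S e"
    and G: "\<And>t. gmean t A B = diag_congr S (\<lambda>i. e i powr t)"
    unfolding diag_congr_def by blast+
  have M: "amean t A B = diag_congr S (\<lambda>i. 1 - t + t * e i)" for t
    by (simp add: amean_def A B diag_congr_add diag_congr_scaleR)
  \<comment> \<open>Both sides become \<open>diag_congr S\<close> of explicit functions of
    \<open>e i\<close>; by monotonicity one scalar inequality per eigenvalue remains.\<close>
  show ?thesis
    unfolding G M diag_congr_add diag_congr_diff diag_congr_scaleR diag_congr_sum
  proof (intro conjI impI diag_congr_mono; elim conjE)
    fix i
    assume "0 \<le> \<nu>" "\<nu> \<le> 1/2"
    from scalar_refined_young_lower[OF e[of i] this, of N]
    show "1 - \<nu> + \<nu> * e i + (\<Sum>j=1..N. s_coef j (2 * \<nu>) *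
        (e i powr (1 - beta_exp j \<nu>) + e i powr (1 - 2 powi (- int j) - beta_exp j \<nu>)
         - 2 * e i powr (1 - 2 powi (- int j - 1) - beta_exp j \<nu>)))
      \<le> e i powr \<nu> + 2 * (1 - \<nu>) * (1 - 1/2 + 1/2 * e i - e i powr (1/2))"
      by (simp add: add_divide_distrib)
  next
    fix i
    assume "1/2 \<le> \<nu>" "\<nu> \<le> 1"
    from scalar_refined_young_upper[OF e[of i] this, of N]
    show "1 - \<nu> + \<nu> * e i + (\<Sum>j=1..N. s_coef j (2 - 2 * \<nu>) *
        (e i powr (gamma_exp j \<nu>) + e i powr (gamma_exp j \<nu> + 2 powi (- int j))
         - 2 * e i powr (gamma_exp j \<nu> + 2 powi (- int j - 1))))
      \<le> e i powr \<nu> + 2 * \<nu> * (1 - 1/2 + 1/2 * e i - e i powr (1/2))"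
      by (simp add: add_divide_distrib)
  qed
qed

end
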